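(* Let $Q\in\mathrm{Gr}(k,n)$ with eigendecomposition $Q=VI_{k,n-k}V^{\mathsf T}$, $V\in\mathrm{O}(n)$. The tangent space of $\mathrm{Gr}(k,n)$ at $Q$ is \begin{align*} \mathbb{T}_Q\mathrm{Gr}(k,n)&=\{X\in\mathbb{R}^{n\times n}:X^{\mathsf T}=X,\ XQ+QX=0,\ \operatorname{tr}(X)=0\}\\ &=\left\{V\begin{bmatrix}0 & B \\ B^{\mathsf T} & 0\end{bmatrix}V^{\mathsf T}:B\in\mathbb{R}^{k\times(n-k)}\right\}\\ &=\left\{QV\begin{bmatrix}0 & B \\ -B^{\mathsf T} & 0\end{bmatrix}V^{\mathsf T}:B\in\mathbb{R}^{k\times(n-k)}\right\}. \end{align*}
   Context: For $k\in\{1,\dots,n\}$, the Grassmannian is identified with the submanifold $\mathrm{Gr}(k,n)=\{Q\in\mathrm{O}(n):Q^{\mathsf T}=Q,\ \operatorname{tr}(Q)=2k-n\}$ of $\mathbb{R}^{n\times n}$, and tangent spaces are regarded as linear subspaces of $\mathbb{R}^{n\times n}$. $I_{k,n-k}=\operatorname{diag}(I_k,-I_{n-k})$. Every $Q\in\mathrm{Gr}(k,n)$ can be written as $Q=VI_{k,n-k}V^{\mathsf T}$ for some (non-unique) $V\in\mathrm{O}(n)$. *)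

theory Defs
  imports "HOL-Analysis.Derivative" "Jordan_Normal_Form.Matrix"
begin

definition trace_mat :: "'a :: comm_monoid_add mat \<Rightarrow> 'a" where
  "trace_mat A = (\<Sum>i<dim_row A. A $$ (i, i))"

definition orthogonal_group :: "nat \<Rightarrow> real mat set" where
  "orthogonal_group n = {V \<in> carrier_mat n n. V\<^sup>T * V = 1\<^sub>m n \<and> V * V\<^sup>T = 1\<^sub>m n}"

definition Grassmannian :: "nat \<Rightarrow> nat \<Rightarrow> real mat set" where
  "Grassmannian k n =
    {Q \<in> orthogonal_group n. Q\<^sup>T = Q \<and> trace_mat Q = 2 * real k - real n}"

text \<open>The matrix \<open>I\<^bsub>p,q\<^esub> = diag (I\<^bsub>p\<^esub>, -I\<^bsub>q\<^esub>)\<close>.\<close>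

definition signature_mat :: "nat \<Rightarrow> nat \<Rightarrow> real mat" where
  "signature_mat p q = four_block_mat (1\<^sub>m p) (0\<^sub>m p q) (0\<^sub>m q p) (- 1\<^sub>m q)"

text \<open>\<open>C\<^sup>\<infinity>\<close> functions of one real variable. The set \<open>S\<close> is meant to be open, since
  \<^const>\<open>deriv\<close> is the two-sided derivative.\<close>

definition smooth_real_on :: "(real \<Rightarrow> real) \<Rightarrow> real set \<Rightarrow> bool" where
  "smooth_real_on f S \<longleftrightarrow> (\<forall>m. (deriv ^^ m) f differentiable_on S)"

text \<open>The tangent space at \<open>Q\<close> of a submanifold \<open>M\<close> of the space of \<open>n \<times> n\<close> real matrices,
  as a set of matrices: the velocities at time \<open>0\<close> of the smooth curves in \<open>M\<close> through \<open>Q\<close>.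
  The type \<^typ>\<open>real mat\<close> contains matrices of all sizes and so has no norm; smoothness and
  velocity of a curve of \<open>n \<times> n\<close> matrices are therefore expressed by its \<open>n\<^sup>2\<close> coordinate
  functions. Values of \<open>\<gamma>\<close> outside the interval are irrelevant.\<close>

definition tangent_space_mat :: "nat \<Rightarrow> real mat set \<Rightarrow> real mat \<Rightarrow> real mat set" where
  "tangent_space_mat n M Q = {X \<in> carrier_mat n n.
    \<exists>(\<gamma> :: real \<Rightarrow> real mat) \<epsilon>. \<epsilon> > 0 \<and> (\<forall>t\<in>{-\<epsilon><..<\<epsilon>}. \<gamma> t \<in> M) \<and> \<gamma> 0 = Q \<and>
      (\<forall>i<n. \<forall>j<n. smooth_real_on (\<lambda>t. \<gamma> t $$ (i, j)) {-\<epsilon><..<\<epsilon>} \<and>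
        ((\<lambda>t. \<gamma> t $$ (i, j)) has_real_derivative X $$ (i, j)) (at 0))}"

end

theory Submission
  imports Defs
begin

text \<open>Differentiating \<open>\<gamma>\<^sup>T = \<gamma>\<close> and \<open>\<gamma>\<^sup>2 = 1\<close> shows that every velocity \<open>X\<close> is symmetric and
  anticommutes with \<open>Q\<close>; the trace condition is then automatic. Conversely, for such an \<open>X\<close> the
  matrix \<open>A = Q X\<close> is skew-symmetric and anticommutes with \<open>Q\<close>, and \<open>\<gamma> t = Q exp (t A)\<close> is a curve
  in the Grassmannian with velocity \<open>Q A = X\<close>: it is symmetric, and \<open>\<gamma>' = \<gamma> A = - A \<gamma>\<close> makes the
  derivatives of \<open>\<gamma>\<^sup>2\<close> and of the trace of \<open>\<gamma>\<close> vanish. The block descriptions come from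
  conjugating with \<open>V\<close>: a matrix anticommutes with \<open>diag (1, -1)\<close> iff its diagonal blocks vanish.\<close>

section \<open>Matrix algebra\<close>

lemma mult_mat_sum_index:
  assumes "A \<in> carrier_mat n m" "B \<in> carrier_mat m p" "i < n" "j < p"
  shows "(A * B) $$ (i, j) = (\<Sum>l<m. A $$ (i, l) * B $$ (l, j))"
  using assms by (auto simp: scalar_prod_def atLeast0LessThan intro!: sum.cong)

lemma trace_mat_mult_commute:
  fixes A B :: "'a :: comm_semiring_0 mat"
  assumes A: "A \<in> carrier_mat n m" and B: "B \<in> carrier_mat m n"
  shows "trace_mat (A * B) = trace_mat (B * A)"
proof -
  have "trace_mat (A * B) = (\<Sum>i<n. \<Sum>l<m. A $$ (i, l) * B $$ (l, i))"
    using A by (auto simp: trace_mat_def mult_mat_sum_index[OF A B] intro!: sum.cong)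
  also have "\<dots> = (\<Sum>l<m. \<Sum>i<n. B $$ (l, i) * A $$ (i, l))"
    by (subst sum.swap) (simp add: mult.commute)
  also have "\<dots> = trace_mat (B * A)"
    using B by (auto simp: trace_mat_def mult_mat_sum_index[OF B A] intro!: sum.cong)
  finally show ?thesis .
qed

lemma trace_mat_uminus:
  fixes A :: "'a :: ab_group_add mat"
  assumes "A \<in> carrier_mat n n"
  shows "trace_mat (- A) = - trace_mat A"
  using assms by (auto simp: trace_mat_def sum_negf[symmetric] intro!: sum.cong)

lemma add_mat_eq_zero_iff:
  fixes A B :: "'a :: ab_group_add mat"
  assumes "A \<in> carrier_mat n m" "B \<in> carrier_mat n m"
  shows "A + B = 0\<^sub>m n m \<longleftrightarrow> A = - B"
  using assms by (auto simp: mat_eq_iff add_eq_0_iff2)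

text \<open>Conjugation by the involution \<open>Q\<close> preserves the trace by cyclicity, but
  anticommutation gives \<open>Q * X * Q = - X\<close>; so the trace equals its own negative. This
  yields the trace condition for tangent vectors.\<close>

lemma trace_mat_anticommuting_involution:
  fixes X Q :: "real mat"
  assumes X: "X \<in> carrier_mat n n" and Q: "Q \<in> carrier_mat n n"
    and QQ: "Q * Q = 1\<^sub>m n" and anti: "X * Q = - (Q * X)"
  shows "trace_mat X = 0"
proof -
  have "Q * X * Q = Q * (X * Q)"
    using X Q by simp
  also have "\<dots> = - (Q * (Q * X))"
    unfolding anti using X Q by simp
  also have "Q * (Q * X) = Q * Q * X"
    using X Q by simp
  also have "\<dots> = X"
    unfolding QQ using X by simp
  finally have "trace_mat (Q * X * Q) = - trace_mat X"
    using trace_mat_uminus[OF X] by simp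
  moreover have "trace_mat (Q * X * Q) = trace_mat (Q * (Q * X))"
    using trace_mat_mult_commute[of "Q * X" n n Q] X Q by simp
  moreover have "Q * (Q * X) = X"
    using assoc_mult_mat[OF Q Q X] QQ X by simp
  ultimately show ?thesis by simp
qed

lemma conjugate_mult_conjugate:
  fixes V W :: "'a :: semiring_1 mat"
  assumes V: "V \<in> carrier_mat n n" and W: "W \<in> carrier_mat n n" and WV: "W * V = 1\<^sub>m n"
    and A: "A \<in> carrier_mat n n" and B: "B \<in> carrier_mat n n"
  shows "(V * A * W) * (V * B * W) = V * (A * B) * W"
proof -
  \<comment> \<open>The dimensions in the carrier premises do not occur in the rewritten equation;
    fixing them all to \<open>n\<close> lets simp discharge these premises.\<close>
  note assoc = assoc_mult_mat[of _ n n _ n _ n] mult_carrier_mat[of _ n n _ n]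
  have "(V * A * W) * (V * B * W) = V * A * (W * (V * (B * W)))"
    using V W A B by (simp add: assoc del: assoc_mult_mat)
  also have "W * (V * (B * W)) = W * V * (B * W)"
    using V W B by (simp add: assoc del: assoc_mult_mat)
  also have "\<dots> = B * W"
    unfolding WV using B W by (simp add: assoc del: assoc_mult_mat)
  finally show ?thesis
    using V W A B by (simp add: assoc del: assoc_mult_mat)
qed

lemma transpose_conjugate:
  fixes V :: "'a :: comm_semiring_0 mat"
  assumes V: "V \<in> carrier_mat n n" and A: "A \<in> carrier_mat n n"
  shows "(V * A * V\<^sup>T)\<^sup>T = V * A\<^sup>T * V\<^sup>T"
proof -
  have "(V * A * V\<^sup>T)\<^sup>T = V * (V * A)\<^sup>T"
    using V A transpose_mult[of "V * A" n n "V\<^sup>T" n] by simp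
  also have "(V * A)\<^sup>T = A\<^sup>T * V\<^sup>T"
    using transpose_mult[OF V A] .
  finally show ?thesis
    using V A by simp
qed

text \<open>Reassociation exposes \<open>V * V\<^sup>T\<close> on both sides of \<open>X\<close>.
  Every square matrix is thus a conjugate by \<open>V\<close>, so questions about \<open>X\<close>
  can be moved to \<open>V\<^sup>T * X * V\<close>.\<close>

lemma orthogonal_conjugate_inverse:
  assumes V: "V \<in> orthogonal_group n" and X: "X \<in> carrier_mat n n"
  shows "V * (V\<^sup>T * X * V) * V\<^sup>T = X"
proof -
  have c: "V \<in> carrier_mat n n" "V * V\<^sup>T = 1\<^sub>m n"
    using V by (auto simp: orthogonal_group_def)
  note assoc = assoc_mult_mat[of _ n n _ n _ n] mult_carrier_mat[of _ n n _ n]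
  have "V * (V\<^sup>T * X * V) * V\<^sup>T = (V * V\<^sup>T) * X * (V * V\<^sup>T)"
    using c(1) X by (simp add: assoc del: assoc_mult_mat)
  then show ?thesis
    using c(2) X by simp
qed

lemma orthogonal_group_transpose:
  "V \<in> orthogonal_group n \<Longrightarrow> V\<^sup>T \<in> orthogonal_group n"
  by (auto simp: orthogonal_group_def)

text \<open>For a symmetric matrix both orthogonality equations collapse to
  \<open>Q * Q = 1\<^sub>m n\<close>, the form that is convenient to differentiate along a
  curve.\<close>

lemma Grassmannian_iff_involution:
  "Q \<in> Grassmannian k n \<longleftrightarrow>
    Q \<in> carrier_mat n n \<and> Q * Q = 1\<^sub>m n \<and> Q\<^sup>T = Q \<and> trace_mat Q = 2 * real k - real n"
  by (auto simp: Grassmannian_def orthogonal_group_def)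

section \<open>The block form\<close>

lemma signature_mat_carrier: "signature_mat p q \<in> carrier_mat (p + q) (p + q)"
  unfolding signature_mat_def by simp

lemma signature_mat_index:
  "i < p + q \<Longrightarrow> j < p + q \<Longrightarrow>
    signature_mat p q $$ (i, j) = (if i = j then if i < p then 1 else -1 else 0)"
  unfolding signature_mat_def by auto

lemma mult_signature_mat_index:
  assumes "M \<in> carrier_mat (p + q) (p + q)" "i < p + q" "j < p + q"
  shows "(M * signature_mat p q) $$ (i, j) = M $$ (i, j) * (if j < p then 1 else -1)"
    and "(signature_mat p q * M) $$ (i, j) = (if i < p then 1 else -1) * M $$ (i, j)"
proof -
  have "(M * signature_mat p q) $$ (i, j) =
      (\<Sum>l<p+q. if l = j then M $$ (i, l) * (if j < p then 1 else -1) else 0)"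
    unfolding mult_mat_sum_index[OF assms(1) signature_mat_carrier assms(2,3)]
    using assms by (intro sum.cong) (auto simp: signature_mat_index)
  then show "(M * signature_mat p q) $$ (i, j) = M $$ (i, j) * (if j < p then 1 else -1)"
    using assms by (simp add: sum.delta)
  have "(signature_mat p q * M) $$ (i, j) =
      (\<Sum>l<p+q. if l = i then (if i < p then 1 else -1) * M $$ (l, j) else 0)"
    unfolding mult_mat_sum_index[OF signature_mat_carrier assms]
    using assms by (intro sum.cong) (auto simp: signature_mat_index)
  then show "(signature_mat p q * M) $$ (i, j) = (if i < p then 1 else -1) * M $$ (i, j)"
    using assms by (simp add: sum.delta)
qed

text \<open>With signs s_i on the diagonal of the signature matrix, anticommutation reads (s_i +
  s_j) M_ij = 0. It kills exactly the entries with equal signs, that is the diagonal blocks, and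
  symmetry ties the two remaining blocks together.\<close>

lemma anticommuting_signature_iff_offdiagonal:
  fixes M :: "real mat"
  assumes M: "M \<in> carrier_mat (p + q) (p + q)"
  shows "M\<^sup>T = M \<and> M * signature_mat p q = - (signature_mat p q * M) \<longleftrightarrow>
    (\<exists>B \<in> carrier_mat p q. M = four_block_mat (0\<^sub>m p p) B (B\<^sup>T) (0\<^sub>m q q))"
proof
  assume L: "M\<^sup>T = M \<and> M * signature_mat p q = - (signature_mat p q * M)"
  have sym: "M $$ (j, i) = M $$ (i, j)" if "i < p + q" "j < p + q" for i j
    using L M that by (metis index_transpose_mat(1) carrier_matD)
  have anti: "M $$ (i, j) * (if j < p then 1 else -1) = - ((if i < p then 1 else -1) * M $$ (i, j))"
    if ij: "i < p + q" "j < p + q" for i j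
  proof -
    have "(M * signature_mat p q) $$ (i, j) = (- (signature_mat p q * M)) $$ (i, j)"
      using L by simp
    then show ?thesis
      \<comment> \<open>Without \<open>index_mult_mat(1)\<close> the product entries stay folded, so
        the sign rules can rewrite them before they become scalar products.\<close>
      using M ij mult_signature_mat_index[OF M ij] signature_mat_carrier[of p q]
      by (simp del: index_mult_mat(1))
  qed
  \<comment> \<open>The witness is the upper right block of \<open>M\<close>; the column offset
    \<open>p\<close> skips the upper left block.\<close>
  define B where "B = mat p q (\<lambda>(i, j). M $$ (i, p + j))"
  have "M = four_block_mat (0\<^sub>m p p) B (B\<^sup>T) (0\<^sub>m q q)"
  proof (rule eq_matI)
    fix i j
    assume "i < dim_row (four_block_mat (0\<^sub>m p p) B (B\<^sup>T) (0\<^sub>m q q))"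
      "j < dim_col (four_block_mat (0\<^sub>m p p) B (B\<^sup>T) (0\<^sub>m q q))"
    then have ij: "i < p + q" "j < p + q" by auto
    show "M $$ (i, j) = four_block_mat (0\<^sub>m p p) B (B\<^sup>T) (0\<^sub>m q q) $$ (i, j)"
      using ij anti[OF ij] sym[OF ij] by (auto simp: B_def split: if_splits)
  qed (use M in \<open>auto simp: B_def\<close>)
  moreover have "B \<in> carrier_mat p q"
    by (simp add: B_def)
  ultimately show "\<exists>B \<in> carrier_mat p q. M = four_block_mat (0\<^sub>m p p) B (B\<^sup>T) (0\<^sub>m q q)"
    by blast
next
  assume "\<exists>B \<in> carrier_mat p q. M = four_block_mat (0\<^sub>m p p) B (B\<^sup>T) (0\<^sub>m q q)"
  then obtain B where B: "B \<in> carrier_mat p q"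
    and MB: "M = four_block_mat (0\<^sub>m p p) B (B\<^sup>T) (0\<^sub>m q q)" by blast
  have "M\<^sup>T = M"
    unfolding MB using B by (subst transpose_four_block_mat[of _ p p _ q _ q]) auto
  moreover have "M * signature_mat p q = - (signature_mat p q * M)"
  proof (rule eq_matI)
    fix i j
    assume "i < dim_row (- (signature_mat p q * M))" "j < dim_col (- (signature_mat p q * M))"
    then have ij: "i < p + q" "j < p + q"
      using M signature_mat_carrier[of p q] by auto
    have "M $$ (i, j) * (if j < p then 1 else -1) = - ((if i < p then 1 else -1) * M $$ (i, j))"
      using ij B by (auto simp: MB)
    then show "(M * signature_mat p q) $$ (i, j) = (- (signature_mat p q * M)) $$ (i, j)"
      using M ij mult_signature_mat_index[OF M ij] signature_mat_carrier[of p q]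
      by (simp del: index_mult_mat(1))
  qed (use M signature_mat_carrier[of p q] in auto)
  ultimately show "M\<^sup>T = M \<and> M * signature_mat p q = - (signature_mat p q * M)" by blast
qed

text \<open>Left multiplication negates the last \<open>q\<close> rows only, which turns
  \<open>- B\<^sup>T\<close> into \<open>B\<^sup>T\<close>. This links the symmetric and the skew
  block descriptions.\<close>

lemma signature_mult_skew_block:
  assumes "B \<in> carrier_mat p q"
  shows "signature_mat p q * four_block_mat (0\<^sub>m p p) B (- B\<^sup>T) (0\<^sub>m q q) =
    four_block_mat (0\<^sub>m p p) B (B\<^sup>T) (0\<^sub>m q q)"
proof (rule eq_matI)
  let ?S = "four_block_mat (0\<^sub>m p p) B (- B\<^sup>T) (0\<^sub>m q q)"
  let ?M = "four_block_mat (0\<^sub>m p p) B (B\<^sup>T) (0\<^sub>m q q)"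
  have S: "?S \<in> carrier_mat (p + q) (p + q)" by simp
  fix i j assume "i < dim_row ?M" "j < dim_col ?M"
  then have ij: "i < p + q" "j < p + q" by auto
  show "(signature_mat p q * ?S) $$ (i, j) = ?M $$ (i, j)"
    unfolding mult_signature_mat_index(2)[OF S ij] using ij assms by auto
qed (use signature_mat_carrier[of p q] in auto)

text \<open>Conjugation by \<open>V\<close> respects products, negation and transposes and is
  injective, so the claim for \<open>Q\<close> reduces to the one for the signature matrix, applied
  to \<open>V\<^sup>T * X * V\<close>.\<close>

lemma anticommuting_iff_conjugate_offdiagonal:
  fixes Q V X :: "real mat"
  assumes V: "V \<in> orthogonal_group (p + q)" and Q: "Q = V * signature_mat p q * V\<^sup>T"
    and X: "X \<in> carrier_mat (p + q) (p + q)"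
  shows "X\<^sup>T = X \<and> X * Q = - (Q * X) \<longleftrightarrow>
    (\<exists>B \<in> carrier_mat p q. X = V * four_block_mat (0\<^sub>m p p) B (B\<^sup>T) (0\<^sub>m q q) * V\<^sup>T)"
proof -
  let ?n = "p + q"
  let ?S = "signature_mat p q"
  have Vc: "V \<in> carrier_mat ?n ?n" "V\<^sup>T \<in> carrier_mat ?n ?n" "V\<^sup>T * V = 1\<^sub>m ?n"
    using V by (auto simp: orthogonal_group_def)
  have S: "?S \<in> carrier_mat ?n ?n" by (rule signature_mat_carrier)
  have undo: "V\<^sup>T * (V * A * V\<^sup>T) * V = A" if "A \<in> carrier_mat ?n ?n" for A
    using orthogonal_conjugate_inverse[OF orthogonal_group_transpose[OF V] that] by simp
  have inj: "A = B" if "A \<in> carrier_mat ?n ?n" "B \<in> carrier_mat ?n ?n"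
    "V * A * V\<^sup>T = V * B * V\<^sup>T" for A B
    using that undo by metis
  have conj: "(V * A * V\<^sup>T)\<^sup>T = V * A * V\<^sup>T \<and> V * A * V\<^sup>T * Q = - (Q * (V * A * V\<^sup>T)) \<longleftrightarrow>
      A\<^sup>T = A \<and> A * ?S = - (?S * A)"
    if A: "A \<in> carrier_mat ?n ?n" for A
  proof -
    have "(V * A * V\<^sup>T)\<^sup>T = V * A * V\<^sup>T \<longleftrightarrow> A\<^sup>T = A"
      unfolding transpose_conjugate[OF Vc(1) A] using inj[of "A\<^sup>T" A] A by auto
    moreover have "V * A * V\<^sup>T * Q = V * (A * ?S) * V\<^sup>T"
      unfolding Q by (rule conjugate_mult_conjugate[OF Vc A S])
    moreover have "- (Q * (V * A * V\<^sup>T)) = V * (- (?S * A)) * V\<^sup>T"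
      unfolding Q conjugate_mult_conjugate[OF Vc S A] using Vc S A by simp
    ultimately show ?thesis
      using inj[of "A * ?S" "- (?S * A)"] A S by auto
  qed
  let ?M = "V\<^sup>T * X * V"
  have M: "?M \<in> carrier_mat ?n ?n"
    using Vc(1) X by simp
  have XM: "X = V * ?M * V\<^sup>T"
    using orthogonal_conjugate_inverse[OF V X] by simp
  have "X\<^sup>T = X \<and> X * Q = - (Q * X) \<longleftrightarrow> ?M\<^sup>T = ?M \<and> ?M * ?S = - (?S * ?M)"
    using conj[OF M] XM by simp
  also have "\<dots> \<longleftrightarrow> (\<exists>B \<in> carrier_mat p q. ?M = four_block_mat (0\<^sub>m p p) B (B\<^sup>T) (0\<^sub>m q q))"
    by (rule anticommuting_signature_iff_offdiagonal[OF M])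
  also have "\<dots> \<longleftrightarrow> (\<exists>B \<in> carrier_mat p q.
      X = V * four_block_mat (0\<^sub>m p p) B (B\<^sup>T) (0\<^sub>m q q) * V\<^sup>T)"
    using XM undo by (metis four_block_carrier_mat zero_carrier_mat)
  finally show ?thesis .
qed

section \<open>Velocities of curves in the Grassmannian\<close>

text \<open>The defining equations of the Grassmannian hold along a curve only for small times, so
  the function is exchanged for the constant on an open interval before uniqueness of derivatives is
  used.\<close>

lemma has_real_derivative_locally_const:
  assumes "(f has_real_derivative d) (at 0)" "\<epsilon> > 0" "\<And>t. t \<in> {-\<epsilon><..<\<epsilon>} \<Longrightarrow> f t = c"
  shows "d = 0"
proof -
  have "((\<lambda>t. c) has_real_derivative d) (at 0)"
    by (rule has_field_derivative_transform_within_open[OF assms(1), of "{-\<epsilon><..<\<epsilon>}"])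
      (use assms(2,3) in auto)
  then show ?thesis
    using DERIV_unique DERIV_const by blast
qed

lemma tangent_space_Grassmannian_anticommute:
  assumes "X \<in> tangent_space_mat n (Grassmannian k n) Q"
  shows "X\<^sup>T = X \<and> X * Q = - (Q * X)"
proof -
  obtain \<gamma> \<epsilon> where X: "X \<in> carrier_mat n n" and e: "\<epsilon> > 0"
    and G: "\<And>t. t \<in> {-\<epsilon><..<\<epsilon>} \<Longrightarrow> \<gamma> t \<in> Grassmannian k n" and "\<gamma> 0 = Q"
    and D: "\<And>i j. i < n \<Longrightarrow> j < n \<Longrightarrow> ((\<lambda>t. \<gamma> t $$ (i, j)) has_real_derivative X $$ (i, j)) (at 0)"
    using assms unfolding tangent_space_mat_def by blast
  have c: "\<gamma> t \<in> carrier_mat n n" "\<gamma> t * \<gamma> t = 1\<^sub>m n" "(\<gamma> t)\<^sup>T = \<gamma> t" if "t \<in> {-\<epsilon><..<\<epsilon>}" for t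
    using G[OF that] by (auto simp: Grassmannian_iff_involution)
  have Q: "Q \<in> carrier_mat n n"
    using c(1)[of 0] e \<open>\<gamma> 0 = Q\<close> by auto
  have "X $$ (j, i) = X $$ (i, j)" if ij: "i < n" "j < n" for i j
  proof -
    have "X $$ (j, i) - X $$ (i, j) = 0"
    proof (rule has_real_derivative_locally_const[OF DERIV_diff[OF D D] e])
      fix t assume t: "t \<in> {-\<epsilon><..<\<epsilon>}"
      have "\<gamma> t $$ (j, i) = \<gamma> t $$ (i, j)"
        using c[OF t] ij by (metis index_transpose_mat(1) carrier_matD)
      then show "\<gamma> t $$ (j, i) - \<gamma> t $$ (i, j) = 0" by simp
    qed (use ij in auto)
    then show ?thesis by simp
  qed
  then have "X\<^sup>T = X"
    using X by (auto simp: mat_eq_iff)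
  moreover have "(X * Q) $$ (i, j) + (Q * X) $$ (i, j) = 0" if ij: "i < n" "j < n" for i j
  proof -
    \<comment> \<open>By the product rule the derivative at 0 is an entry of
      \<open>X * Q + Q * X\<close>, while the differentiated function is constantly an entry of the
      identity matrix.\<close>
    have "((\<lambda>t. \<Sum>l<n. \<gamma> t $$ (i, l) * \<gamma> t $$ (l, j)) has_real_derivative
        (\<Sum>l<n. X $$ (i, l) * \<gamma> 0 $$ (l, j) + X $$ (l, j) * \<gamma> 0 $$ (i, l))) (at 0)"
      using ij by (intro DERIV_sum DERIV_mult D) auto
    then have "(\<Sum>l<n. X $$ (i, l) * \<gamma> 0 $$ (l, j) + X $$ (l, j) * \<gamma> 0 $$ (i, l)) = 0"
    proof (rule has_real_derivative_locally_const[OF _ e])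
      fix t assume t: "t \<in> {-\<epsilon><..<\<epsilon>}"
      show "(\<Sum>l<n. \<gamma> t $$ (i, l) * \<gamma> t $$ (l, j)) = 1\<^sub>m n $$ (i, j)"
        using c[OF t] mult_mat_sum_index[of "\<gamma> t" n n "\<gamma> t" n i j] ij by simp
    qed
    then show ?thesis
      unfolding mult_mat_sum_index[OF X Q ij] mult_mat_sum_index[OF Q X ij] \<open>\<gamma> 0 = Q\<close>
      by (simp add: sum.distrib mult.commute)
  qed
  then have "X * Q + Q * X = 0\<^sub>m n n"
    using X Q by (intro eq_matI) (auto simp del: index_mult_mat(1))
  then have "X * Q = - (Q * X)"
    using add_mat_eq_zero_iff[of "X * Q" n n "Q * X"] X Q by simp
  ultimately show ?thesis by blast
qed

section \<open>Smooth curves with a prescribed velocity\<close>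

text \<open>The derivative of an everywhere convergent power series is again one, with coefficients
  \<open>diffs c\<close>; hence the induction on the order with \<open>c\<close> arbitrary.\<close>

lemma smooth_real_on_entire:
  fixes c :: "nat \<Rightarrow> real"
  assumes "\<And>t. summable (\<lambda>m. c m * t ^ m)"
  shows "smooth_real_on (\<lambda>t. \<Sum>m. c m * t ^ m) S"
  unfolding smooth_real_on_def
proof
  fix r
  show "(deriv ^^ r) (\<lambda>t. \<Sum>m. c m * t ^ m) differentiable_on S"
    using assms
  proof (induction r arbitrary: c)
    case 0
    then show ?case
      using termdiffs_strong_converges_everywhere[OF 0]
      by (auto simp: differentiable_on_def real_differentiable_def intro: DERIV_subset)
  next
    case (Suc r)
    have "deriv (\<lambda>t. \<Sum>m. c m * t ^ m) = (\<lambda>t. \<Sum>m. diffs c m * t ^ m)"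
      using termdiffs_strong_converges_everywhere[OF Suc.prems] by (intro ext DERIV_imp_deriv)
    \<comment> \<open>The innermost \<open>deriv\<close> is split off, so that the induction
      hypothesis applies to the coefficients \<open>diffs c\<close>.\<close>
    then show ?case
      using Suc.IH[OF termdiff_converges_all[OF Suc.prems]]
      by (simp add: funpow_swap1 del: funpow.simps add: funpow_Suc_right)
  qed
qed

text \<open>The recurrence is right multiplication by the array \<open>A\<close>, so entries grow at
  most geometrically, like \<open>K * L ^ m\<close>. The factorial then allows comparison with the
  series of K exp (L |t|).\<close>

lemma summable_exponential_of_linear_recurrence:
  fixes C :: "nat \<Rightarrow> nat \<Rightarrow> nat \<Rightarrow> real"
  assumes rec: "\<And>m i j. i < n \<Longrightarrow> j < n \<Longrightarrow> C (Suc m) i j = (\<Sum>l<n. C m i l * A l j)"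
    and ij: "i < n" "j < n"
  shows "summable (\<lambda>m. C m i j / fact m * t ^ m)"
proof -
  define K where "K = (\<Sum>i<n. \<Sum>j<n. \<bar>C 0 i j\<bar>)"
  define L where "L = (\<Sum>j<n. \<Sum>l<n. \<bar>A l j\<bar>)"
  have L0: "L \<ge> 0"
    unfolding L_def by (intro sum_nonneg) auto
  have bound: "\<bar>C m i j\<bar> \<le> K * L ^ m" if "i < n" "j < n" for m i j
    using that
  proof (induction m arbitrary: j)
    case 0
    have "\<bar>C 0 i j\<bar> \<le> (\<Sum>j<n. \<bar>C 0 i j\<bar>)"
      using 0 by (intro member_le_sum[where f = "\<lambda>j. \<bar>C 0 i j\<bar>"]) auto
    also have "\<dots> \<le> K"
      unfolding K_def using 0
      by (intro member_le_sum[where f = "\<lambda>i. \<Sum>j<n. \<bar>C 0 i j\<bar>"]) (auto intro: sum_nonneg)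
    finally show ?case by simp
  next
    case (Suc m)
    \<comment> \<open>The induction hypothesis at column 0, which exists because
      \<open>j < n\<close>, bounds an absolute value by this product.\<close>
    have K0: "0 \<le> K * L ^ m"
      using Suc.IH[of 0] Suc.prems by fastforce
    have "\<bar>C (Suc m) i j\<bar> \<le> (\<Sum>l<n. \<bar>C m i l\<bar> * \<bar>A l j\<bar>)"
      unfolding rec[OF Suc.prems] abs_mult[symmetric] by (rule sum_abs)
    also have "\<dots> \<le> (\<Sum>l<n. K * L ^ m * \<bar>A l j\<bar>)"
      using Suc by (intro sum_mono mult_right_mono) auto
    also have "\<dots> = K * L ^ m * (\<Sum>l<n. \<bar>A l j\<bar>)"
      by (simp add: sum_distrib_left)
    also have "\<dots> \<le> K * L ^ m * L"
      using K0 unfolding L_def using Suc.prems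
      by (intro mult_left_mono member_le_sum[where f = "\<lambda>j. \<Sum>l<n. \<bar>A l j\<bar>"])
        (auto intro: sum_nonneg)
    finally show ?case by (simp add: ac_simps)
  qed
  show ?thesis
  proof (rule summable_comparison_test'[where N = 0])
    show "summable (\<lambda>m. K * (inverse (fact m) * (L * \<bar>t\<bar>) ^ m))"
      by (intro summable_mult summable_exp)
    fix m :: nat
    have "norm (C m i j / fact m * t ^ m) = \<bar>C m i j\<bar> * (\<bar>t\<bar> ^ m / fact m)"
      by (simp add: abs_mult power_abs)
    also have "\<dots> \<le> K * L ^ m * (\<bar>t\<bar> ^ m / fact m)"
      using bound[OF ij] by (intro mult_right_mono) auto
    finally show "norm (C m i j / fact m * t ^ m) \<le> K * (inverse (fact m) * (L * \<bar>t\<bar>) ^ m)"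
      by (simp add: power_mult_distrib divide_inverse ac_simps)
  qed
qed

text \<open>The curve Q exp (t A) is built entry by entry from scalar power series. That it stays in
  the Grassmannian follows from its two linear differential equations: the square and the trace have
  zero derivative and the right value at 0.\<close>

lemma anticommuting_in_tangent_space_Grassmannian:
  assumes QG: "Q \<in> Grassmannian k n" and X: "X \<in> carrier_mat n n"
    and sym: "X\<^sup>T = X" and anti: "X * Q = - (Q * X)"
  shows "X \<in> tangent_space_mat n (Grassmannian k n) Q"
proof -
  have Q: "Q \<in> carrier_mat n n" "Q * Q = 1\<^sub>m n" "Q\<^sup>T = Q" "trace_mat Q = 2 * real k - real n"
    using QG by (auto simp: Grassmannian_iff_involution)
  \<comment> \<open>The velocity of Q exp (t A) at 0 is \<open>Q * A\<close>, and
    \<open>Q * Q = 1\<^sub>m n\<close> makes this equal to \<open>X\<close>.\<close>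
  define A where "A = Q * X"
  have A: "A \<in> carrier_mat n n"
    using Q X by (simp add: A_def)
  have QA: "Q * A = X"
    unfolding A_def using assoc_mult_mat[OF Q(1) Q(1) X] Q(2) X by simp
  have "A * Q = Q * (X * Q)"
    unfolding A_def using Q X by simp
  then have AQ: "A * Q = - (Q * A)"
    unfolding anti using Q X by (simp add: A_def)
  have At: "A\<^sup>T = - A"
    unfolding A_def using transpose_mult[OF Q(1) X] anti Q(3) sym by simp
  \<comment> \<open>These are the derivatives of Q exp (t A) at 0, so the Taylor coefficients are
    their entries divided by \<open>fact m\<close>.\<close>
  define C where "C m = Q * A ^\<^sub>m m" for m
  have C: "C m \<in> carrier_mat n n" for m
    using Q A by (simp add: C_def)
  have C0: "C 0 = Q"
    using Q A by (simp add: C_def)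
  have C1: "C (Suc m) = C m * A" for m
    using assoc_mult_mat[OF Q(1) pow_carrier_mat[OF A, of m] A] by (simp add: C_def)
  \<comment> \<open>Moving \<open>A\<close> to the right past the single factor \<open>Q\<close>
    costs one sign. This sign cancels that of the skew matrix \<open>A\<close> when
    \<open>C (Suc m)\<close> is transposed.\<close>
  have C2: "A * C m = - C (Suc m)" for m
  proof (induction m)
    case 0
    then show ?case using C1[of 0] C0 AQ by simp
  next
    case (Suc m)
    have "A * C (Suc m) = A * C m * A"
      unfolding C1[of m] using A C[of m] by simp
    then show ?case
      unfolding Suc C1[of "Suc m"] using A C[of "Suc m"] by simp
  qed
  have Ct: "(C m)\<^sup>T = C m" for m
  proof (induction m)
    case 0
    then show ?case by (simp add: C0 Q)
  next
    case (Suc m)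
    have "(C (Suc m))\<^sup>T = - A * C m"
      unfolding C1[of m] transpose_mult[OF C A] Suc At ..
    then show ?case
      using A C[of m] C2[of m] by simp
  qed
  define g where "g i j t = (\<Sum>m. C m $$ (i, j) / fact m * t ^ m)" for i j and t :: real
  have rec: "C (Suc m) $$ (i, j) = (\<Sum>l<n. C m $$ (i, l) * A $$ (l, j))"
    if "i < n" "j < n" for m i j
    unfolding C1 by (rule mult_mat_sum_index[OF C A that])
  have summ: "summable (\<lambda>m. C m $$ (i, j) / fact m * t ^ m)" if "i < n" "j < n" for i j t
    using summable_exponential_of_linear_recurrence[of n "\<lambda>m i j. C m $$ (i, j)" "\<lambda>l j. A $$ (l, j)",
        OF rec that] .
  have gsym: "g j i t = g i j t" if "i < n" "j < n" for i j t
  proof -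
    have "C m $$ (j, i) = C m $$ (i, j)" for m
      using Ct[of m] C[of m] that by (metis index_transpose_mat(1) carrier_matD)
    then show ?thesis by (simp add: g_def)
  qed
  have g0: "g i j 0 = Q $$ (i, j)" for i j
    unfolding g_def using powser_zero[of "\<lambda>m. C m $$ (i, j) / fact m"] by (simp add: C0)
  \<comment> \<open>Entrywise form of \<gamma>' = \<gamma> A: \<open>diffs\<close> cancels one
    factor of the factorial, and the recurrence for \<open>C\<close> pulls \<open>A\<close> out of
    the series.\<close>
  have Dg: "(g i j has_real_derivative (\<Sum>l<n. g i l t * A $$ (l, j))) (at t)"
    if ij: "i < n" "j < n" for i j t
  proof -
    have "diffs (\<lambda>m. C m $$ (i, j) / fact m) m * t ^ m =
        (\<Sum>l<n. C m $$ (i, l) / fact m * t ^ m * A $$ (l, j))" for m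
    proof -
      have "diffs (\<lambda>m. C m $$ (i, j) / fact m) m * t ^ m = C (Suc m) $$ (i, j) / fact m * t ^ m"
        by (simp add: diffs_def divide_simps)
      then show ?thesis
        unfolding rec[OF ij] sum_divide_distrib sum_distrib_right by (simp add: ac_simps)
    qed
    then have "(\<Sum>m. diffs (\<lambda>m. C m $$ (i, j) / fact m) m * t ^ m) =
        (\<Sum>m. \<Sum>l<n. C m $$ (i, l) / fact m * t ^ m * A $$ (l, j))" by simp
    also have "\<dots> = (\<Sum>l<n. \<Sum>m. C m $$ (i, l) / fact m * t ^ m * A $$ (l, j))"
      using ij summ by (intro suminf_sum summable_mult2) auto
    also have "\<dots> = (\<Sum>l<n. g i l t * A $$ (l, j))"
      unfolding g_def using ij summ by (intro sum.cong suminf_mult2[symmetric]) auto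
    finally show ?thesis
      using termdiffs_strong_converges_everywhere[OF summ[OF ij], of t] unfolding g_def by simp
  qed
  have Askew: "A $$ (j, i) = - A $$ (i, j)" if "i < n" "j < n" for i j
  proof -
    have "A\<^sup>T $$ (i, j) = (- A) $$ (i, j)" by (simp add: At)
    then show ?thesis using A that by simp
  qed
  \<comment> \<open>Transposing the previous equation, with \<open>g\<close> symmetric and
    \<open>A\<close> skew, gives \<gamma>' = - A \<gamma>.\<close>
  have Dg': "(g i j has_real_derivative - (\<Sum>l<n. A $$ (i, l) * g l j t)) (at t)"
    if ij: "i < n" "j < n" for i j t
  proof -
    have "g j i = g i j" using gsym[OF ij] by auto
    moreover have "(\<Sum>l<n. g j l t * A $$ (l, i)) = - (\<Sum>l<n. A $$ (i, l) * g l j t)"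
      unfolding sum_negf[symmetric]
    proof (intro sum.cong refl)
      fix l assume "l \<in> {..<n}"
      then show "g j l t * A $$ (l, i) = - (A $$ (i, l) * g l j t)"
        using gsym[of l j t] Askew[of i l] ij by simp
    qed
    ultimately show ?thesis
      using Dg[of j i t] ij by simp
  qed
  have square: "(\<Sum>l<n. g i l t * g l j t) = 1\<^sub>m n $$ (i, j)" if ij: "i < n" "j < n" for i j t
  proof -
    have "((\<lambda>t. \<Sum>l<n. g i l t * g l j t) has_real_derivative 0) (at t)" for t
    proof -
      \<comment> \<open>Using one equation for each factor, the derivative of the square is
        (\<gamma> A) \<gamma> - \<gamma> (A \<gamma>), which vanishes by associativity.\<close>
      have "((\<lambda>t. \<Sum>l<n. g i l t * g l j t) has_real_derivative
          (\<Sum>l<n. (\<Sum>r<n. g i r t * A $$ (r, l)) * g l j t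
            + - (\<Sum>r<n. A $$ (l, r) * g r j t) * g i l t)) (at t)"
        using ij by (intro DERIV_sum DERIV_mult Dg Dg') auto
      moreover have "(\<Sum>l<n. (\<Sum>r<n. g i r t * A $$ (r, l)) * g l j t) =
          (\<Sum>l<n. (\<Sum>r<n. A $$ (l, r) * g r j t) * g i l t)"
        unfolding sum_distrib_right by (subst sum.swap) (simp add: ac_simps)
      ultimately show ?thesis
        by (simp add: sum_subtractf)
    qed
    then have "(\<Sum>l<n. g i l t * g l j t) = (\<Sum>l<n. g i l 0 * g l j 0)"
      by (intro DERIV_isconst_all[of "\<lambda>t. \<Sum>l<n. g i l t * g l j t"]) auto
    then show ?thesis
      using mult_mat_sum_index[OF Q(1) Q(1) ij] Q(2) by (simp add: g0)
  qed
  have trace: "(\<Sum>i<n. g i i t) = trace_mat Q" for t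
  proof -
    have "((\<lambda>t. \<Sum>i<n. g i i t) has_real_derivative 0) (at t)" for t
    proof -
      \<comment> \<open>The two equations give the derivative of the trace as tr (\<gamma> A) and as
        - tr (A \<gamma>). Since these traces agree up to the sign, both are 0.\<close>
      have D: "((\<lambda>t. \<Sum>i<n. g i i t) has_real_derivative
          (\<Sum>i<n. \<Sum>l<n. g i l t * A $$ (l, i))) (at t)"
        by (intro DERIV_sum Dg) auto
      have "((\<lambda>t. \<Sum>i<n. g i i t) has_real_derivative
          (\<Sum>i<n. - (\<Sum>l<n. A $$ (i, l) * g l i t))) (at t)"
        by (intro DERIV_sum Dg') auto
      then have "(\<Sum>i<n. \<Sum>l<n. g i l t * A $$ (l, i)) = - (\<Sum>i<n. \<Sum>l<n. A $$ (i, l) * g l i t)"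
        unfolding sum_negf[symmetric] by (rule DERIV_unique[OF D])
      moreover have "(\<Sum>i<n. \<Sum>l<n. g i l t * A $$ (l, i)) = (\<Sum>i<n. \<Sum>l<n. A $$ (i, l) * g l i t)"
        by (subst sum.swap) (simp add: mult.commute)
      ultimately show ?thesis
        using D by simp
    qed
    then have "(\<Sum>i<n. g i i t) = (\<Sum>i<n. g i i 0)"
      by (intro DERIV_isconst_all[of "\<lambda>t. \<Sum>i<n. g i i t"]) auto
    then show ?thesis
      using Q(1) by (simp add: g0 trace_mat_def)
  qed
  define \<gamma> where "\<gamma> t = mat n n (\<lambda>(i, j). g i j t)" for t
  have entry: "(\<lambda>t. \<gamma> t $$ (i, j)) = g i j" if "i < n" "j < n" for i j
    using that by (auto simp: \<gamma>_def)
  have \<gamma>c: "\<gamma> t \<in> carrier_mat n n" for t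
    by (simp add: \<gamma>_def)
  have "\<gamma> t * \<gamma> t = 1\<^sub>m n" for t
  proof (rule eq_matI)
    fix i j assume "i < dim_row (1\<^sub>m n :: real mat)" "j < dim_col (1\<^sub>m n :: real mat)"
    then have ij: "i < n" "j < n" by auto
    show "(\<gamma> t * \<gamma> t) $$ (i, j) = 1\<^sub>m n $$ (i, j)"
      unfolding mult_mat_sum_index[OF \<gamma>c \<gamma>c ij] square[OF ij, of t, symmetric]
      using ij by (intro sum.cong) (auto simp: \<gamma>_def)
  qed (auto simp: \<gamma>_def)
  moreover have "(\<gamma> t)\<^sup>T = \<gamma> t" for t
    by (rule eq_matI) (auto simp: \<gamma>_def gsym)
  moreover have "trace_mat (\<gamma> t) = 2 * real k - real n" for t
    using trace[of t] Q(4) by (simp add: trace_mat_def \<gamma>_def)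
  ultimately have "\<gamma> t \<in> Grassmannian k n" for t
    using \<gamma>c by (simp add: Grassmannian_iff_involution)
  moreover have "\<gamma> 0 = Q"
    using Q(1) by (auto simp: \<gamma>_def g0 mat_eq_iff)
  moreover have "smooth_real_on (\<lambda>t. \<gamma> t $$ (i, j)) {-1<..<1}" if ij: "i < n" "j < n" for i j
  proof -
    have "g i j = (\<lambda>t. \<Sum>m. C m $$ (i, j) / fact m * t ^ m)"
      by (auto simp: g_def)
    then show ?thesis
      unfolding entry[OF ij] using smooth_real_on_entire[OF summ[OF ij]] by simp
  qed
  moreover have "((\<lambda>t. \<gamma> t $$ (i, j)) has_real_derivative X $$ (i, j)) (at 0)"
    if ij: "i < n" "j < n" for i j
    unfolding entry[OF ij] QA[symmetric] mult_mat_sum_index[OF Q(1) A ij]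
    using Dg[OF ij, of 0] by (simp add: g0)
  \<comment> \<open>The curve lies in the Grassmannian for all times, so the radius 1 is an
    arbitrary choice.\<close>
  ultimately show ?thesis
    unfolding tangent_space_mat_def using X by (auto intro!: exI[of _ \<gamma>] exI[of _ "1::real"])
qed

section \<open>Agreement of the three descriptions of the tangent space\<close>

theorem proposition3p1:
  fixes k n :: nat and Q V :: "real mat"
  assumes "1 \<le> k" and "k \<le> n"
    and "Q \<in> Grassmannian k n"
    and "V \<in> orthogonal_group n"
    and "Q = V * signature_mat k (n - k) * V\<^sup>T"
  shows "(tangent_space_mat n (Grassmannian k n) Q =
      {X \<in> carrier_mat n n. X\<^sup>T = X \<and> X * Q + Q * X = 0\<^sub>m n n \<and> trace_mat X = 0}) \<and>
    ({X \<in> carrier_mat n n. X\<^sup>T = X \<and> X * Q + Q * X = 0\<^sub>m n n \<and> trace_mat X = 0} =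
      {V * four_block_mat (0\<^sub>m k k) B (B\<^sup>T) (0\<^sub>m (n - k) (n - k)) * V\<^sup>T | B.
        B \<in> carrier_mat k (n - k)}) \<and>
    ({V * four_block_mat (0\<^sub>m k k) B (B\<^sup>T) (0\<^sub>m (n - k) (n - k)) * V\<^sup>T | B.
        B \<in> carrier_mat k (n - k)} =
      {Q * V * four_block_mat (0\<^sub>m k k) B (- B\<^sup>T) (0\<^sub>m (n - k) (n - k)) * V\<^sup>T | B.
        B \<in> carrier_mat k (n - k)})"
proof -
  \<comment> \<open>Writing \<open>n = k + q\<close> matches the dimensions of the block lemmas and
    avoids natural subtraction.\<close>
  define q where "q = n - k"
  have n: "n = k + q"
    using assms(2) by (simp add: q_def)
  have Q: "Q \<in> carrier_mat n n" "Q * Q = 1\<^sub>m n"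
    using assms(3) by (auto simp: Grassmannian_iff_involution)
  have V: "V \<in> carrier_mat n n" "V\<^sup>T * V = 1\<^sub>m n"
    using assms(4) by (auto simp: orthogonal_group_def)
  define N where "N = {X \<in> carrier_mat n n. X\<^sup>T = X \<and> X * Q + Q * X = 0\<^sub>m n n \<and> trace_mat X = 0}"
  have N: "X \<in> N \<longleftrightarrow> X \<in> carrier_mat n n \<and> X\<^sup>T = X \<and> X * Q = - (Q * X)" for X
    using add_mat_eq_zero_iff[of "X * Q" n n "Q * X"] Q
      trace_mat_anticommuting_involution[of X n Q] by (auto simp: N_def)
  have "tangent_space_mat n (Grassmannian k n) Q = N"
  proof (rule Set.set_eqI)
    fix X
    have "X \<in> carrier_mat n n" if "X \<in> tangent_space_mat n (Grassmannian k n) Q"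
      using that by (simp add: tangent_space_mat_def)
    then show "X \<in> tangent_space_mat n (Grassmannian k n) Q \<longleftrightarrow> X \<in> N"
      using tangent_space_Grassmannian_anticommute[of X n k Q]
        anticommuting_in_tangent_space_Grassmannian[OF assms(3), of X]
      by (auto simp: N)
  qed
  moreover have "N = {V * four_block_mat (0\<^sub>m k k) B (B\<^sup>T) (0\<^sub>m q q) * V\<^sup>T | B. B \<in> carrier_mat k q}"
  proof -
    have "V * four_block_mat (0\<^sub>m k k) B (B\<^sup>T) (0\<^sub>m q q) * V\<^sup>T \<in> carrier_mat n n" for B
      using V(1) by (simp add: n mult_carrier_mat[of _ "k + q" "k + q"])
    moreover have "X\<^sup>T = X \<and> X * Q = - (Q * X) \<longleftrightarrow>
        (\<exists>B \<in> carrier_mat k q. X = V * four_block_mat (0\<^sub>m k k) B (B\<^sup>T) (0\<^sub>m q q) * V\<^sup>T)"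
      if "X \<in> carrier_mat n n" for X
      using anticommuting_iff_conjugate_offdiagonal[of V k q Q X] assms(4,5) that
      unfolding n by simp
    ultimately show ?thesis
      using N by blast
  qed
  moreover have "Q * V * four_block_mat (0\<^sub>m k k) B (- B\<^sup>T) (0\<^sub>m q q) * V\<^sup>T =
      V * four_block_mat (0\<^sub>m k k) B (B\<^sup>T) (0\<^sub>m q q) * V\<^sup>T" if B: "B \<in> carrier_mat k q" for B
  proof -
    let ?S = "signature_mat k q"
    let ?K = "four_block_mat (0\<^sub>m k k) B (- B\<^sup>T) (0\<^sub>m q q)"
    have S: "?S \<in> carrier_mat n n" and K: "?K \<in> carrier_mat n n"
      using signature_mat_carrier[of k q] by (simp_all add: n)
    \<comment> \<open>Cancelling \<open>V\<^sup>T * V\<close> leaves the signature matrix next to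
      the skew block, where it restores the symmetric block with the same \<open>B\<close>.\<close>
    have "Q * V = V * ?S * (V\<^sup>T * V)"
      unfolding assms(5) q_def[symmetric] using V(1) S
      by (simp add: assoc_mult_mat[of _ n n _ n _ n] mult_carrier_mat[of _ n n _ n] del: assoc_mult_mat)
    then have "Q * V = V * ?S"
      using V S by simp
    then have "Q * V * ?K = V * (?S * ?K)"
      using V(1) S K by simp
    then show ?thesis
      unfolding signature_mult_skew_block[OF B] by simp
  qed
  then have "{V * four_block_mat (0\<^sub>m k k) B (B\<^sup>T) (0\<^sub>m q q) * V\<^sup>T | B. B \<in> carrier_mat k q} =
      {Q * V * four_block_mat (0\<^sub>m k k) B (- B\<^sup>T) (0\<^sub>m q q) * V\<^sup>T | B. B \<in> carrier_mat k q}"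
    by (intro Collect_cong ex_cong1) metis
  ultimately show ?thesis
    unfolding N_def[symmetric] q_def[symmetric] by simp
qed

end
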